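(* In the downlink PD-NOMA model of the context (one subcarrier, $K=1$), assume $a_m>\varepsilon_m a_n$. Consider the connection outage probability of the $n$-th user for the existing formulation (EXF), $P_{n1}(\rho)=\Pr\{\gamma_{n\to m}\le\varepsilon_m\}+\Pr\{\gamma_{n\to m}>\varepsilon_m,\ \gamma_n\le\varepsilon_n\}$. Its diversity order is $0$ with imperfect SIC ($\varpi=1$) and $n$ with perfect SIC ($\varpi=0$).
   Context: Fix integers $M\ge2$ and $1\le m<n\le M$, reals $\eta,\alpha,R_D,\Omega_I>0$, power coefficients $a_m>a_n>0$ with $a_m+a_n=1$, and target rates $R_m,R_n>0$ with $\varepsilon_m=2^{R_m}-1$, $\varepsilon_n=2^{R_n}-1$; $\rho>0$ is the transmit SNR. $M$ users are placed independently and uniformly in a disc of radius $R_D$ centred at the base station. A user at distance $d$ from the centre has channel coefficient $\sqrt{\eta}\,h/\sqrt{1+d^\alpha}$ with $h\sim\mathcal{CN}(0,1)$ (circularly symmetric, $\mathbb{E}|h|^2=1$), independent across users and of the locations. Users are relabelled so that their squared channel moduli satisfy $Z_1<\dots<Z_M$. The residual interference coefficient $h_I\sim\mathcal{CN}(0,\Omega_I)$ is independent of everything else, and $Y_I=|h_I|^2$. SINRs: $\gamma_{n\to m}=\frac{\rho Z_n a_m}{\rho Z_n a_n+1}$ and $\gamma_n=\frac{\rho Z_n a_n}{\varpi\rho Y_I+1}$. Diversity order of an outage probability $P(\rho)$: $d=-\lim_{\rho\to\infty}\frac{\log P^\infty(\rho)}{\log\rho}$, where $P^\infty$ is the asymptotic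 outage probability at high SNR, i.e. $P(\rho)/P^\infty(\rho)\to1$ as $\rho\to\infty$. *)

theory Defs
  imports "HOL-Probability.Probability"
begin

text \<open>The plane of user locations is identified with the complex numbers, the base station
  being the origin.\<close>

definition uniform_disc_density :: "real \<Rightarrow> complex \<Rightarrow> ennreal" where
  "uniform_disc_density R x = indicator (cball 0 R) x / emeasure lborel (cball (0::complex) R)"

text \<open>Law of a circularly symmetric complex Gaussian variable with second absolute moment \<open>v\<close>.\<close>

definition CN_density :: "real \<Rightarrow> complex \<Rightarrow> ennreal" where
  "CN_density v z = ennreal (exp (- ((cmod z)\<^sup>2 / v)) / (pi * v))"

text \<open>Labels for the independent sources of randomness: the location and the small-scale fading
  of each user, and the residual interference coefficient.\<close>

datatype source = Location nat | Fading nat | Residual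

definition sources :: "nat \<Rightarrow> source set" where
  "sources M = Location ` {1..M} \<union> Fading ` {1..M} \<union> {Residual}"

fun source_var ::
  "(nat \<Rightarrow> 'a \<Rightarrow> complex) \<Rightarrow> (nat \<Rightarrow> 'a \<Rightarrow> complex) \<Rightarrow> ('a \<Rightarrow> complex) \<Rightarrow> source \<Rightarrow> 'a \<Rightarrow> complex"
where
  "source_var X h hI (Location i) = X i"
| "source_var X h hI (Fading i) = h i"
| "source_var X h hI Residual = hI"

definition channel_coeff :: "real \<Rightarrow> real \<Rightarrow> complex \<Rightarrow> complex \<Rightarrow> complex" where
  "channel_coeff \<eta> \<alpha> x g =
     complex_of_real (sqrt \<eta>) * g / complex_of_real (sqrt (1 + cmod x powr \<alpha>))"

text \<open>The \<open>k\<close>-th smallest of the \<open>M\<close> squared channel moduli, counted from \<open>k = 1\<close>.\<close>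

definition ordered_gain ::
  "real \<Rightarrow> real \<Rightarrow> nat \<Rightarrow> (nat \<Rightarrow> 'a \<Rightarrow> complex) \<Rightarrow> (nat \<Rightarrow> 'a \<Rightarrow> complex) \<Rightarrow> nat \<Rightarrow> 'a \<Rightarrow> real"
where
  "ordered_gain \<eta> \<alpha> M X h k \<omega> =
     sort (map (\<lambda>i. (cmod (channel_coeff \<eta> \<alpha> (X i \<omega>) (h i \<omega>)))\<^sup>2) [1..<Suc M]) ! (k - 1)"

text \<open>SINRs with \<open>z\<close> the gain of the receiving user: first for decoding the weaker user's signal,
  then for its own signal after SIC, with residual interference power \<open>y\<close>.\<close>

definition sinr_cross :: "real \<Rightarrow> real \<Rightarrow> real \<Rightarrow> real \<Rightarrow> real" where
  "sinr_cross a\<^sub>m a\<^sub>n \<rho> z = \<rho> * z * a\<^sub>m / (\<rho> * z * a\<^sub>n + 1)"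

definition sinr_own :: "real \<Rightarrow> real \<Rightarrow> real \<Rightarrow> real \<Rightarrow> real \<Rightarrow> real" where
  "sinr_own w a\<^sub>n \<rho> z y = \<rho> * z * a\<^sub>n / (w * \<rho> * y + 1)"

definition exf_outage ::
  "'a measure \<Rightarrow> real \<Rightarrow> real \<Rightarrow> real \<Rightarrow> real \<Rightarrow> real \<Rightarrow> ('a \<Rightarrow> real) \<Rightarrow> ('a \<Rightarrow> real) \<Rightarrow> real \<Rightarrow> real"
where
  "exf_outage P a\<^sub>m a\<^sub>n \<epsilon>\<^sub>m \<epsilon>\<^sub>n w Z Y \<rho> =
     measure P {\<omega> \<in> space P. sinr_cross a\<^sub>m a\<^sub>n \<rho> (Z \<omega>) \<le> \<epsilon>\<^sub>m}
   + measure P {\<omega> \<in> space P. sinr_cross a\<^sub>m a\<^sub>n \<rho> (Z \<omega>) > \<epsilon>\<^sub>m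
                            \<and> sinr_own w a\<^sub>n \<rho> (Z \<omega>) (Y \<omega>) \<le> \<epsilon>\<^sub>n}"

definition high_snr_asymptote :: "(real \<Rightarrow> real) \<Rightarrow> (real \<Rightarrow> real) \<Rightarrow> bool" where
  "high_snr_asymptote p q \<longleftrightarrow> ((\<lambda>\<rho>. p \<rho> / q \<rho>) \<longlongrightarrow> 1) at_top"

text \<open>The asymptotic outage probability is only determined up to asymptotic equivalence; the
  diversity order must come out the same for every choice, and the existence clause excludes a
  vacuous reading.\<close>

definition has_diversity_order :: "(real \<Rightarrow> real) \<Rightarrow> real \<Rightarrow> bool" where
  "has_diversity_order p d \<longleftrightarrow>
     (\<exists>q. high_snr_asymptote p q) \<and>
     (\<forall>q. high_snr_asymptote p q \<longrightarrow> ((\<lambda>\<rho>. - (ln (q \<rho>) / ln \<rho>)) \<longlongrightarrow> d) at_top)"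

end

theory Submission
  imports Defs "HOL-Real_Asymp.Real_Asymp"
begin

text \<open>
  The outage probability is only needed up to constant factors. With perfect SIC the outage event is
  $Z_n \le \tau/\rho$ for a constant $\tau > 0$. It contains the event that $h_1, \dots, h_n$ are all
  small and, since locations are bounded, is almost surely contained in the union over the $n$-subsets
  $S$ of the events that the $h_i$, $i \in S$, are all small. As
  $|h_i|^2 \le s$ has probability of order $s$, both bounds have order $\rho^{-n}$. With imperfect
  SIC, signal and interference scale alike with $\rho$, so a fixed event of positive probability
  (small $h_1, \dots, h_n$ and large $h_I$) is contained in the outage event for every $\rho$.
\<close>

section \<open>Diversity order from two-sided power bounds\<close>

text \<open>Constant factors add only O(1) to the logarithm and vanish after division by
  \<open>ln \<rho>\<close>. Any \<open>q\<close> asymptotic to \<open>p\<close> lies eventually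
  between \<open>p / 2\<close> and \<open>2 * p\<close>, so it inherits both bounds up to a factor
  2.\<close>

lemma has_diversity_orderI:
  fixes p :: "real \<Rightarrow> real"
  assumes "c > 0"
    and lower: "eventually (\<lambda>\<rho>. c * \<rho> powr - d \<le> p \<rho>) at_top"
    and upper: "eventually (\<lambda>\<rho>. p \<rho> \<le> C * \<rho> powr - d) at_top"
  shows "has_diversity_order p d"
  unfolding has_diversity_order_def
proof (intro conjI allI impI)
  have pos: "eventually (\<lambda>\<rho>. p \<rho> > 0) at_top"
    using lower eventually_gt_at_top[of 0]
  proof eventually_elim
    case (elim \<rho>)
    have "0 < c * \<rho> powr - d" using elim \<open>c > 0\<close> by simp
    then show ?case using elim by linarith
  qed
  \<comment> \<open>The witness is \<open>p\<close> itself: it is eventually positive, so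
    \<open>p \<rho> / p \<rho>\<close> is eventually 1.\<close>
  show "\<exists>q. high_snr_asymptote p q"
    unfolding high_snr_asymptote_def
  proof (intro exI tendsto_eventually)
    show "eventually (\<lambda>\<rho>. p \<rho> / p \<rho> = 1) at_top"
      using pos by eventually_elim simp
  qed
  fix q assume "high_snr_asymptote p q"
  then have "((\<lambda>\<rho>. p \<rho> / q \<rho>) \<longlongrightarrow> 1) at_top"
    by (simp add: high_snr_asymptote_def)
  then have "eventually (\<lambda>\<rho>. p \<rho> / q \<rho> > 1/2) at_top" "eventually (\<lambda>\<rho>. p \<rho> / q \<rho> < 2) at_top"
    by (rule order_tendstoD; simp)+
  then have bounds: "eventually (\<lambda>\<rho>. d - ln (2 * C) / ln \<rho> \<le> - (ln (q \<rho>) / ln \<rho>) \<and>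
      - (ln (q \<rho>) / ln \<rho>) \<le> d - ln (c / 2) / ln \<rho>) at_top"
    using pos lower upper eventually_gt_at_top[of 1]
  proof eventually_elim
    case (elim \<rho>)
    \<comment> \<open>With \<open>p \<rho> > 0\<close>, a nonpositive \<open>q \<rho>\<close> would
      make the quotient nonpositive (division by zero yields 0), against the bound 1/2.\<close>
    then have "q \<rho> > 0"
      using divide_nonneg_nonpos[of "p \<rho>" "q \<rho>"] by linarith
    then have q: "q \<rho> \<ge> p \<rho> / 2" "q \<rho> \<le> 2 * p \<rho>"
      using elim by (simp_all add: field_simps)
    have "0 < C * \<rho> powr - d" using elim by linarith
    then have C: "C > 0" by (simp add: zero_less_mult_iff)
    have "c / 2 * \<rho> powr - d \<le> q \<rho>" "q \<rho> \<le> 2 * C * \<rho> powr - d"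
      using elim q by auto
    then have "ln (c / 2 * \<rho> powr - d) \<le> ln (q \<rho>)" "ln (q \<rho>) \<le> ln (2 * C * \<rho> powr - d)"
      using \<open>c > 0\<close> \<open>q \<rho> > 0\<close> elim C by auto
    moreover have "ln (c / 2 * \<rho> powr - d) = ln (c / 2) - d * ln \<rho>"
      using \<open>c > 0\<close> elim by (subst ln_mult_pos) (auto simp: ln_powr)
    moreover have "ln (2 * C * \<rho> powr - d) = ln (2 * C) - d * ln \<rho>"
      using C elim by (subst ln_mult_pos) (auto simp: ln_powr)
    ultimately have "ln (c / 2) - d * ln \<rho> \<le> ln (q \<rho>)" "ln (q \<rho>) \<le> ln (2 * C) - d * ln \<rho>"
      by simp_all
    moreover have "ln \<rho> > 0" using elim by simp
    ultimately have "ln (c / 2) / ln \<rho> - d \<le> ln (q \<rho>) / ln \<rho>"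
        "ln (q \<rho>) / ln \<rho> \<le> ln (2 * C) / ln \<rho> - d"
      by (simp_all add: pos_le_divide_eq pos_divide_le_eq left_diff_distrib)
    then show ?case by simp
  qed
  have lim: "((\<lambda>\<rho>. d - K / ln \<rho>) \<longlongrightarrow> d) at_top" for K :: real
    by real_asymp
  show "((\<lambda>\<rho>. - (ln (q \<rho>) / ln \<rho>)) \<longlongrightarrow> d) at_top"
    using bounds by (intro tendsto_sandwich[OF _ _ lim lim]) (auto elim: eventually_mono)
qed

section \<open>Order statistics as counting conditions\<close>

text \<open>In a sorted list the entries at most \<open>t\<close> form a prefix, so position
  \<open>k\<close> belongs to it exactly when the prefix is longer than \<open>k\<close>.\<close>

lemma sorted_nth_le_iff:
  fixes xs :: "'a :: linorder list"
  assumes "sorted xs" "k < length xs"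
  shows "xs ! k \<le> t \<longleftrightarrow> k < length (filter (\<lambda>x. x \<le> t) xs)"
  using assms
proof (induction xs arbitrary: k)
  case (Cons x xs)
  show ?case
  proof (cases "x \<le> t")
    case True
    with Cons show ?thesis by (cases k) auto
  next
    case False
    with Cons.prems have "filter (\<lambda>x. x \<le> t) xs = []"
      by (auto simp: filter_empty_conv)
    moreover have "x \<le> (x # xs) ! k"
      using Cons.prems by (cases k) auto
    ultimately show ?thesis using False by auto
  qed
qed simp

text \<open>Sorting does not change how many entries are at most \<open>t\<close>, and
  \<open>1 \<le> k\<close> turns \<open>k - 1 < card T\<close> into \<open>k \<le> card T\<close>.
  The right-hand side is a finite union of finite intersections, a form suited to independence and
  union bounds.\<close>

lemma sort_nth_le_iff:
  fixes g :: "nat \<Rightarrow> 'a :: linorder"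
  assumes "1 \<le> k" "k \<le> M"
  shows "sort (map g [1..<Suc M]) ! (k - 1) \<le> t \<longleftrightarrow>
    (\<exists>S. S \<subseteq> {1..M} \<and> card S = k \<and> (\<forall>i\<in>S. g i \<le> t))"
proof -
  define T where "T = {i \<in> {1..M}. g i \<le> t}"
  have "length (filter (\<lambda>x. x \<le> t) (sort (map g [1..<Suc M]))) =
      length (filter (\<lambda>i. g i \<le> t) [1..<Suc M])"
    by (simp add: filter_sort filter_map o_def del: upt_Suc)
  also have "\<dots> = card (set (filter (\<lambda>i. g i \<le> t) [1..<Suc M]))"
    by (rule distinct_card[symmetric]) simp
  also have "set (filter (\<lambda>i. g i \<le> t) [1..<Suc M]) = T"
    by (auto simp: T_def)
  finally have "sort (map g [1..<Suc M]) ! (k - 1) \<le> t \<longleftrightarrow> k \<le> card T"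
    using assms by (subst sorted_nth_le_iff) auto
  also have "\<dots> \<longleftrightarrow> (\<exists>S. S \<subseteq> {1..M} \<and> card S = k \<and> (\<forall>i\<in>S. g i \<le> t))"
  proof
    assume "k \<le> card T"
    then obtain S where "S \<subseteq> T" "card S = k" by (meson obtain_subset_with_card_n)
    then show "\<exists>S. S \<subseteq> {1..M} \<and> card S = k \<and> (\<forall>i\<in>S. g i \<le> t)"
      unfolding T_def by (intro exI[of _ S]) auto
  next
    assume "\<exists>S. S \<subseteq> {1..M} \<and> card S = k \<and> (\<forall>i\<in>S. g i \<le> t)"
    then obtain S where "S \<subseteq> {1..M}" "card S = k" "\<forall>i\<in>S. g i \<le> t" by blast
    then have "S \<subseteq> T" by (auto simp: T_def)
    then show "k \<le> card T" using card_mono[of T S] \<open>card S = k\<close> by (simp add: T_def)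
  qed
  finally show ?thesis .
qed

section \<open>Bounds on a single gain and measurability of the ordered gain\<close>

lemma channel_gain_eq:
  assumes "\<eta> > 0"
  shows "(cmod (channel_coeff \<eta> \<alpha> x g))\<^sup>2 = \<eta> * (cmod g)\<^sup>2 / (1 + cmod x powr \<alpha>)"
  using assms by (simp add: channel_coeff_def norm_mult norm_divide power_mult_distrib
      power_divide add_pos_nonneg add_nonneg_nonneg)

lemma channel_gain_le:
  assumes "\<eta> > 0"
  shows "(cmod (channel_coeff \<eta> \<alpha> x g))\<^sup>2 \<le> \<eta> * (cmod g)\<^sup>2"
proof -
  have "\<eta> * (cmod g)\<^sup>2 / (1 + cmod x powr \<alpha>) \<le> \<eta> * (cmod g)\<^sup>2 / 1"
    using assms by (intro divide_left_mono mult_pos_pos add_pos_nonneg) auto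
  then show ?thesis using assms by (simp add: channel_gain_eq)
qed

text \<open>The path loss is greatest at the edge of the disc. Together with
  \<open>channel_gain_le\<close> this traps the gain between two multiples of the squared fading
  modulus that do not depend on the location.\<close>

lemma channel_gain_ge:
  assumes "\<eta> > 0" "\<alpha> > 0" "cmod x \<le> R"
  shows "\<eta> * (cmod g)\<^sup>2 / (1 + R powr \<alpha>) \<le> (cmod (channel_coeff \<eta> \<alpha> x g))\<^sup>2"
  using assms
  by (auto simp: channel_gain_eq intro!: divide_left_mono powr_mono2 mult_pos_pos add_pos_nonneg)

lemma channel_coeff_measurable [measurable]:
  assumes [measurable]: "f \<in> borel_measurable N" "g \<in> borel_measurable N"
  shows "(\<lambda>x. channel_coeff \<eta> \<alpha> (f x) (g x)) \<in> borel_measurable N"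
  unfolding channel_coeff_def by measurable

lemma ordered_gain_nonneg:
  assumes "1 \<le> k" "k \<le> M"
  shows "0 \<le> ordered_gain \<eta> \<alpha> M X h k \<omega>"
proof -
  let ?xs = "map (\<lambda>i. (cmod (channel_coeff \<eta> \<alpha> (X i \<omega>) (h i \<omega>)))\<^sup>2) [1..<Suc M]"
  have "sort ?xs ! (k - 1) \<in> set (sort ?xs)"
    using assms by (intro nth_mem) auto
  then show ?thesis
    unfolding ordered_gain_def by auto
qed

lemma ordered_gain_le_iff:
  assumes "1 \<le> k" "k \<le> M"
  shows "ordered_gain \<eta> \<alpha> M X h k \<omega> \<le> t \<longleftrightarrow>
    (\<exists>S. S \<subseteq> {1..M} \<and> card S = k \<and> (\<forall>i\<in>S. (cmod (channel_coeff \<eta> \<alpha> (X i \<omega>) (h i \<omega>)))\<^sup>2 \<le> t))"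
  unfolding ordered_gain_def by (rule sort_nth_le_iff[OF assms])

text \<open>Each sublevel set is a finite union, over the \<open>k\<close>-subsets of users, of
  finite intersections of measurable sets.\<close>

lemma ordered_gain_measurable:
  assumes "1 \<le> k" "k \<le> M"
    and X: "\<And>i. i \<in> {1..M} \<Longrightarrow> X i \<in> borel_measurable N"
    and h: "\<And>i. i \<in> {1..M} \<Longrightarrow> h i \<in> borel_measurable N"
  shows "ordered_gain \<eta> \<alpha> M X h k \<in> borel_measurable N"
  unfolding borel_measurable_iff_le
proof
  fix t
  have "{\<omega> \<in> space N. ordered_gain \<eta> \<alpha> M X h k \<omega> \<le> t} =
      {\<omega> \<in> space N. \<exists>S\<in>{S. S \<subseteq> {1..M} \<and> card S = k}.
        \<forall>i\<in>S. (cmod (channel_coeff \<eta> \<alpha> (X i \<omega>) (h i \<omega>)))\<^sup>2 \<le> t}"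
    unfolding ordered_gain_le_iff[OF assms(1,2)] by auto
  also have "\<dots> \<in> sets N"
  proof (intro sets.sets_Collect_finite_Ex)
    fix S assume "S \<in> {S. S \<subseteq> {1..M} \<and> card S = k}"
    then have S: "S \<subseteq> {1..M}" by simp
    show "{\<omega> \<in> space N. \<forall>i\<in>S. (cmod (channel_coeff \<eta> \<alpha> (X i \<omega>) (h i \<omega>)))\<^sup>2 \<le> t} \<in> sets N"
    proof (intro sets.sets_Collect_finite_All)
      show "finite S" using S finite_subset by blast
      fix i assume "i \<in> S"
      with S have "i \<in> {1..M}" by auto
      note [measurable] = X[OF this] h[OF this]
      show "{\<omega> \<in> space N. (cmod (channel_coeff \<eta> \<alpha> (X i \<omega>) (h i \<omega>)))\<^sup>2 \<le> t} \<in> sets N"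
        by measurable
    qed
  qed simp
  finally show "{\<omega> \<in> space N. ordered_gain \<eta> \<alpha> M X h k \<omega> \<le> t} \<in> sets N" .
qed

section \<open>Probability estimates for the Gaussian and uniform laws\<close>

text \<open>The density never exceeds its value \<open>1 / (pi * v)\<close> at the origin, and the
  disc has area \<open>pi * r\<^sup>2\<close>.\<close>

lemma (in prob_space) CN_prob_cball_le:
  assumes Z: "distributed M lborel Z (CN_density v)" and "v > 0" "r \<ge> 0"
  shows "prob {\<omega> \<in> space M. Z \<omega> \<in> cball a r} \<le> r\<^sup>2 / v"
proof -
  have "emeasure M (Z -` cball a r \<inter> space M) = (\<integral>\<^sup>+x. CN_density v x * indicator (cball a r) x \<partial>lborel)"
    by (rule distributed_emeasure[OF Z]) simp
  also have "\<dots> \<le> (\<integral>\<^sup>+x. ennreal (1 / (pi * v)) * indicator (cball a r) x \<partial>lborel)"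
    using \<open>v > 0\<close> unfolding CN_density_def
    by (intro nn_integral_mono mult_right_mono ennreal_leI divide_right_mono) auto
  also have "\<dots> = ennreal (1 / (pi * v)) * emeasure lborel (cball a r)"
    by (subst nn_integral_cmult_indicator) auto
  also have "\<dots> = ennreal (r\<^sup>2 / v)"
    using assms by (simp add: emeasure_cball unit_ball_vol_2 flip: ennreal_mult)
  finally show ?thesis
    using assms by (simp add: emeasure_eq_measure vimage_def Int_def conj_commute)
qed

text \<open>No point of the ball has modulus above \<open>cmod a + r\<close>, and the density
  decreases with the modulus. The centre is kept general because small fading calls for balls at 0
  and large interference for a ball away from 0.\<close>

lemma (in prob_space) CN_prob_cball_ge:
  assumes Z: "distributed M lborel Z (CN_density v)" and "v > 0" "r \<ge> 0"
  shows "exp (- ((cmod a + r)\<^sup>2 / v)) * (r\<^sup>2 / v) \<le> prob {\<omega> \<in> space M. Z \<omega> \<in> cball a r}"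
proof -
  let ?e = "exp (- ((cmod a + r)\<^sup>2 / v))"
  have "ennreal (?e * (r\<^sup>2 / v)) = ennreal (?e / (pi * v)) * emeasure lborel (cball a r)"
    using assms by (simp add: emeasure_cball unit_ball_vol_2 flip: ennreal_mult)
  also have "\<dots> = (\<integral>\<^sup>+x. ennreal (?e / (pi * v)) * indicator (cball a r) x \<partial>lborel)"
    by (subst nn_integral_cmult_indicator) auto
  also have "\<dots> \<le> (\<integral>\<^sup>+x. CN_density v x * indicator (cball a r) x \<partial>lborel)"
  proof (intro nn_integral_mono)
    fix x :: complex
    have "(cmod x)\<^sup>2 \<le> (cmod a + r)\<^sup>2" if "x \<in> cball a r"
      using that norm_triangle_sub[of x a]
      by (intro power_mono) (auto simp: dist_norm norm_minus_commute)
    then show "ennreal (?e / (pi * v)) * indicator (cball a r) x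
        \<le> CN_density v x * indicator (cball a r) x"
      using \<open>v > 0\<close> unfolding CN_density_def
      by (cases "x \<in> cball a r") (auto intro!: ennreal_leI divide_right_mono)
  qed
  also have "\<dots> = emeasure M (Z -` cball a r \<inter> space M)"
    by (rule distributed_emeasure[OF Z, symmetric]) simp
  finally show ?thesis
    by (simp add: emeasure_eq_measure vimage_def Int_def conj_commute)
qed

lemma (in prob_space) uniform_disc_AE:
  assumes Z: "distributed M lborel Z (uniform_disc_density R)"
  shows "AE \<omega> in M. cmod (Z \<omega>) \<le> R"
proof -
  have [measurable]: "Z \<in> M \<rightarrow>\<^sub>M lborel" by (rule distributed_measurable[OF Z])
  have "emeasure M (Z -` (- cball 0 R) \<inter> space M) =
      (\<integral>\<^sup>+x. uniform_disc_density R x * indicator (- cball 0 R) x \<partial>lborel)"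
    by (rule distributed_emeasure[OF Z]) simp
  also have "\<dots> = (\<integral>\<^sup>+(x::complex). 0 \<partial>lborel)"
    by (intro nn_integral_cong) (auto simp: uniform_disc_density_def indicator_def)
  finally have "emeasure M (Z -` (- cball 0 R) \<inter> space M) = 0" by simp
  then have "AE \<omega> in M. \<omega> \<notin> Z -` (- cball 0 R) \<inter> space M"
    by (intro AE_not_in null_setsI) measurable
  then show ?thesis
    by (rule AE_mp) (auto intro!: AE_I2)
qed

lemma (in prob_space) indep_vars_prob_Ball:
  assumes "indep_vars (\<lambda>_. borel) X I" "J \<subseteq> I" "J \<noteq> {}" "finite J"
    and "\<And>j. j \<in> J \<Longrightarrow> A j \<in> sets borel"
  shows "prob {\<omega> \<in> space M. \<forall>j\<in>J. X j \<omega> \<in> A j} = (\<Prod>j\<in>J. prob {\<omega> \<in> space M. X j \<omega> \<in> A j})"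
proof -
  have "{\<omega> \<in> space M. \<forall>j\<in>J. X j \<omega> \<in> A j} = (\<Inter>j\<in>J. X j -` A j \<inter> space M)"
    using \<open>J \<noteq> {}\<close> by auto
  also have "prob \<dots> = (\<Prod>j\<in>J. prob (X j -` A j \<inter> space M))"
    using assms by (intro indep_varsD) auto
  finally show ?thesis
    by (simp add: vimage_def Int_def conj_commute)
qed

section \<open>Outage conditions as linear inequalities\<close>

text \<open>Clearing the positive denominator collects \<open>z\<close> with the factor
  \<open>a - e * b\<close>. When this is positive, as the power allocation assumption ensures, the
  condition is an upper threshold on the gain.\<close>

lemma sinr_cross_le_iff:
  assumes "\<rho> > 0" "z \<ge> 0" "b > 0"
  shows "sinr_cross a b \<rho> z \<le> e \<longleftrightarrow> \<rho> * z * (a - e * b) \<le> e"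
proof -
  have "\<rho> * z * b + 1 > 0"
    using assms by (intro add_nonneg_pos) auto
  then show ?thesis by (simp add: sinr_cross_def field_simps)
qed

lemma sinr_own_le_iff:
  assumes "\<rho> > 0" "w \<ge> 0" "y \<ge> 0"
  shows "sinr_own w b \<rho> z y \<le> e \<longleftrightarrow> \<rho> * z * b \<le> e * (w * \<rho> * y + 1)"
proof -
  have "w * \<rho> * y + 1 > 0"
    using assms by (intro add_nonneg_pos) auto
  then show ?thesis by (simp add: sinr_own_def field_simps)
qed

text \<open>The two events in the definition are disjoint, so their probabilities add up to that of
  the union, in which the condition that the first decoding succeeds disappears.\<close>

lemma (in prob_space) exf_outage_eq:
  assumes [measurable]: "Z \<in> borel_measurable M" "Y \<in> borel_measurable M"
  shows "exf_outage M a b e e' w Z Y \<rho> =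
    prob {\<omega> \<in> space M. sinr_cross a b \<rho> (Z \<omega>) \<le> e \<or> sinr_own w b \<rho> (Z \<omega>) (Y \<omega>) \<le> e'}"
proof -
  have [measurable]: "(\<lambda>\<omega>. sinr_cross a b \<rho> (Z \<omega>)) \<in> borel_measurable M"
    "(\<lambda>\<omega>. sinr_own w b \<rho> (Z \<omega>) (Y \<omega>)) \<in> borel_measurable M"
    unfolding sinr_cross_def sinr_own_def by measurable
  have "{\<omega> \<in> space M. sinr_cross a b \<rho> (Z \<omega>) \<le> e \<or> sinr_own w b \<rho> (Z \<omega>) (Y \<omega>) \<le> e'} =
      {\<omega> \<in> space M. sinr_cross a b \<rho> (Z \<omega>) \<le> e} \<union>
      {\<omega> \<in> space M. sinr_cross a b \<rho> (Z \<omega>) > e \<and> sinr_own w b \<rho> (Z \<omega>) (Y \<omega>) \<le> e'}"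
    by auto
  then show ?thesis
    unfolding exf_outage_def by (simp, subst finite_measure_Union) auto
qed

section \<open>The random channel and independence of its sources\<close>

locale noma_channel = prob_space P for P :: "'a measure" +
  fixes M :: nat and \<eta> \<alpha> R \<Omega> :: real
    and X h :: "nat \<Rightarrow> 'a \<Rightarrow> complex" and hI :: "'a \<Rightarrow> complex"
  assumes \<eta>_pos: "\<eta> > 0" and \<alpha>_pos: "\<alpha> > 0" and \<Omega>_pos: "\<Omega> > 0"
    and indep: "indep_vars (\<lambda>_. borel) (source_var X h hI) (sources M)"
    and location: "\<And>i. i \<in> {1..M} \<Longrightarrow> distributed P lborel (X i) (uniform_disc_density R)"
    and fading: "\<And>i. i \<in> {1..M} \<Longrightarrow> distributed P lborel (h i) (CN_density 1)"
    and residual: "distributed P lborel hI (CN_density \<Omega>)"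
begin

lemma location_measurable: "i \<in> {1..M} \<Longrightarrow> X i \<in> borel_measurable P"
  using distributed_measurable[OF location] by simp

lemma fading_measurable: "i \<in> {1..M} \<Longrightarrow> h i \<in> borel_measurable P"
  using distributed_measurable[OF fading] by simp

lemma residual_measurable: "hI \<in> borel_measurable P"
  using distributed_measurable[OF residual] by simp

lemma gain_measurable:
  "1 \<le> k \<Longrightarrow> k \<le> M \<Longrightarrow> ordered_gain \<eta> \<alpha> M X h k \<in> borel_measurable P"
  by (rule ordered_gain_measurable) (auto intro: location_measurable fading_measurable)

lemma prob_fading:
  assumes "S \<subseteq> {1..M}" "S \<noteq> {}" "\<And>i. i \<in> S \<Longrightarrow> A i \<in> sets borel"
  shows "prob {\<omega> \<in> space P. \<forall>i\<in>S. h i \<omega> \<in> A i} = (\<Prod>i\<in>S. prob {\<omega> \<in> space P. h i \<omega> \<in> A i})"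
proof -
  \<comment> \<open>The sets are reindexed by source labels, since independence is assumed for the
    joint family of all sources.\<close>
  define A' where "A' s = (case s of Fading i \<Rightarrow> A i | _ \<Rightarrow> UNIV)" for s
  have inj: "inj_on Fading S" by (auto simp: inj_on_def)
  have "finite S" using assms(1) finite_subset by blast
  then have "prob {\<omega> \<in> space P. \<forall>s\<in>Fading ` S. source_var X h hI s \<omega> \<in> A' s} =
      (\<Prod>s\<in>Fading ` S. prob {\<omega> \<in> space P. source_var X h hI s \<omega> \<in> A' s})"
    using assms by (intro indep_vars_prob_Ball[OF indep]) (auto simp: sources_def A'_def)
  then show ?thesis
    by (simp add: prod.reindex[OF inj] A'_def)
qed

lemma prob_fading_residual:
  assumes "S \<subseteq> {1..M}" "\<And>i. i \<in> S \<Longrightarrow> A i \<in> sets borel" "B \<in> sets borel"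
  shows "prob {\<omega> \<in> space P. hI \<omega> \<in> B \<and> (\<forall>i\<in>S. h i \<omega> \<in> A i)} =
    prob {\<omega> \<in> space P. hI \<omega> \<in> B} * (\<Prod>i\<in>S. prob {\<omega> \<in> space P. h i \<omega> \<in> A i})"
proof -
  \<comment> \<open>On \<open>?J\<close> the default branch concerns \<open>Residual\<close> alone,
    which thus receives \<open>B\<close>.\<close>
  define A' where "A' s = (case s of Fading i \<Rightarrow> A i | _ \<Rightarrow> B)" for s
  let ?J = "insert Residual (Fading ` S)"
  have inj: "inj_on Fading S" by (auto simp: inj_on_def)
  have "finite S" using assms(1) finite_subset by blast
  moreover from this have "prob {\<omega> \<in> space P. \<forall>s\<in>?J. source_var X h hI s \<omega> \<in> A' s} =
      (\<Prod>s\<in>?J. prob {\<omega> \<in> space P. source_var X h hI s \<omega> \<in> A' s})"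
    using assms by (intro indep_vars_prob_Ball[OF indep]) (auto simp: sources_def A'_def)
  moreover have "Residual \<notin> Fading ` S" by auto
  ultimately show ?thesis
    by (simp add: prod.reindex[OF inj] A'_def)
qed

section \<open>Lower tail of the ordered gain\<close>

text \<open>Path loss only reduces a gain, so small fading of \<open>k\<close> users suffices
  wherever they are; users 1 to \<open>k\<close> serve as the required
  \<open>k\<close>-subset.\<close>

lemma gain_le_if_fading_le:
  assumes "1 \<le> k" "k \<le> M" "t \<ge> 0" "\<forall>i\<in>{1..k}. h i \<omega> \<in> cball 0 (sqrt (t / \<eta>))"
  shows "ordered_gain \<eta> \<alpha> M X h k \<omega> \<le> t"
  unfolding ordered_gain_le_iff[OF assms(1,2)]
proof (intro exI[of _ "{1..k}"] conjI ballI)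
  fix i assume "i \<in> {1..k}"
  then have "(cmod (h i \<omega>))\<^sup>2 \<le> (sqrt (t / \<eta>))\<^sup>2"
    using assms by (intro power_mono) auto
  also have "\<dots> = t / \<eta>"
    using \<eta>_pos \<open>t \<ge> 0\<close> by simp
  finally have "\<eta> * (cmod (h i \<omega>))\<^sup>2 \<le> t"
    using \<eta>_pos by (simp add: field_simps)
  then show "(cmod (channel_coeff \<eta> \<alpha> (X i \<omega>) (h i \<omega>)))\<^sup>2 \<le> t"
    using channel_gain_le[OF \<eta>_pos, of \<alpha> "X i \<omega>" "h i \<omega>"] by linarith
qed (use assms in auto)

text \<open>One fixed set of \<open>k\<close> users already gives the right order: their independent
  fading coefficients each fall in the disc of squared radius \<open>t / \<eta>\<close> with
  probability of order \<open>t\<close>.\<close>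

lemma prob_gain_le_lower:
  assumes "1 \<le> k" "k \<le> M" "t \<ge> 0"
  shows "(exp (- (t / \<eta>)) * (t / \<eta>)) ^ k \<le> prob {\<omega> \<in> space P. ordered_gain \<eta> \<alpha> M X h k \<omega> \<le> t}"
proof -
  note [measurable] = gain_measurable[OF assms(1,2)]
  let ?s = "sqrt (t / \<eta>)"
  have "(exp (- (t / \<eta>)) * (t / \<eta>)) ^ k = (\<Prod>i\<in>{1..k}. exp (- (t / \<eta>)) * (t / \<eta>))"
    by simp
  also have "\<dots> \<le> (\<Prod>i\<in>{1..k}. prob {\<omega> \<in> space P. h i \<omega> \<in> cball 0 ?s})"
  proof (intro prod_mono conjI)
    fix i assume "i \<in> {1..k}"
    then have "i \<in> {1..M}" using assms by auto
    from CN_prob_cball_ge[OF fading[OF this], of ?s 0]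
    show "exp (- (t / \<eta>)) * (t / \<eta>) \<le> prob {\<omega> \<in> space P. h i \<omega> \<in> cball 0 ?s}"
      using \<open>t \<ge> 0\<close> \<eta>_pos by simp
  qed (use \<open>t \<ge> 0\<close> \<eta>_pos in auto)
  also have "\<dots> = prob {\<omega> \<in> space P. \<forall>i\<in>{1..k}. h i \<omega> \<in> cball 0 ?s}"
    using assms by (intro prob_fading[symmetric]) auto
  also have "\<dots> \<le> prob {\<omega> \<in> space P. ordered_gain \<eta> \<alpha> M X h k \<omega> \<le> t}"
    using gain_le_if_fading_le[OF assms] by (intro finite_measure_mono) auto
  finally show ?thesis .
qed

text \<open>Replacing every location by the worst one, at distance \<open>R\<close>, leaves a
  condition on the independent fading coefficients only, so the probability factorises.\<close>

lemma prob_gains_le_upper: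
  assumes "S \<subseteq> {1..M}" "S \<noteq> {}" "t \<ge> 0"
  shows "prob {\<omega> \<in> space P. \<forall>i\<in>S. (cmod (channel_coeff \<eta> \<alpha> (X i \<omega>) (h i \<omega>)))\<^sup>2 \<le> t}
    \<le> (t * (1 + R powr \<alpha>) / \<eta>) ^ card S"
proof -
  have fin: "finite S" using assms(1) finite_subset by blast
  have pos: "1 + R powr \<alpha> > 0" by (intro add_pos_nonneg) auto
  \<comment> \<open>This is the squared fading modulus that produces gain \<open>t\<close> at
    distance \<open>R\<close>.\<close>
  define s where "s = t * (1 + R powr \<alpha>) / \<eta>"
  have "s \<ge> 0" using assms pos \<eta>_pos by (simp add: s_def)
  have meas: "{\<omega> \<in> space P. \<forall>i\<in>S. h i \<omega> \<in> cball 0 (sqrt s)} \<in> events"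
  proof (intro sets.sets_Collect_finite_All fin)
    fix i assume "i \<in> S"
    with assms have "i \<in> {1..M}" by auto
    note [measurable] = fading_measurable[OF this]
    show "{\<omega> \<in> space P. h i \<omega> \<in> cball 0 (sqrt s)} \<in> events"
      unfolding mem_cball by measurable
  qed
  have "AE \<omega> in P. \<forall>i\<in>S. cmod (X i \<omega>) \<le> R"
    using assms by (intro AE_finite_allI[OF fin] uniform_disc_AE location) auto
  \<comment> \<open>The inclusion of events holds only almost surely, because the density of a
    location bounds it by \<open>R\<close> only up to a null set.\<close>
  then have "AE \<omega> in P.
      \<omega> \<in> {\<omega> \<in> space P. \<forall>i\<in>S. (cmod (channel_coeff \<eta> \<alpha> (X i \<omega>) (h i \<omega>)))\<^sup>2 \<le> t} \<longrightarrow>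
      \<omega> \<in> {\<omega> \<in> space P. \<forall>i\<in>S. h i \<omega> \<in> cball 0 (sqrt s)}"
  proof eventually_elim
    case (elim \<omega>)
    have "h i \<omega> \<in> cball 0 (sqrt s)"
      if "i \<in> S" "(cmod (channel_coeff \<eta> \<alpha> (X i \<omega>) (h i \<omega>)))\<^sup>2 \<le> t" for i
    proof -
      have "\<eta> * (cmod (h i \<omega>))\<^sup>2 / (1 + R powr \<alpha>) \<le> t"
        using channel_gain_ge[OF \<eta>_pos \<alpha>_pos, of "X i \<omega>" R "h i \<omega>"] elim that by force
      then have "(cmod (h i \<omega>))\<^sup>2 \<le> s"
        using pos \<eta>_pos by (simp add: s_def field_simps)
      then show ?thesis by (simp add: real_le_rsqrt)
    qed
    then show ?case by auto
  qed
  then have "prob {\<omega> \<in> space P. \<forall>i\<in>S. (cmod (channel_coeff \<eta> \<alpha> (X i \<omega>) (h i \<omega>)))\<^sup>2 \<le> t}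
      \<le> prob {\<omega> \<in> space P. \<forall>i\<in>S. h i \<omega> \<in> cball 0 (sqrt s)}"
    using meas by (rule finite_measure_mono_AE)
  also have "\<dots> = (\<Prod>i\<in>S. prob {\<omega> \<in> space P. h i \<omega> \<in> cball 0 (sqrt s)})"
    using assms by (intro prob_fading) auto
  also have "\<dots> \<le> (\<Prod>i\<in>S. s)"
  proof (intro prod_mono conjI)
    fix i assume "i \<in> S"
    with assms have "i \<in> {1..M}" by auto
    from CN_prob_cball_le[OF fading[OF this], of "sqrt s" 0]
    show "prob {\<omega> \<in> space P. h i \<omega> \<in> cball 0 (sqrt s)} \<le> s"
      using \<open>s \<ge> 0\<close> by simp
  qed auto
  finally show ?thesis by (simp add: s_def)
qed

text \<open>Union bound over the \<open>k\<close>-subsets of users, whose number is the binomial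
  factor.\<close>

lemma prob_gain_le_upper:
  assumes "1 \<le> k" "k \<le> M" "t \<ge> 0"
  shows "prob {\<omega> \<in> space P. ordered_gain \<eta> \<alpha> M X h k \<omega> \<le> t}
    \<le> real (M choose k) * (t * (1 + R powr \<alpha>) / \<eta>) ^ k"
proof -
  define F where "F = {S. S \<subseteq> {1..M} \<and> card S = k}"
  define E where "E S = {\<omega> \<in> space P. \<forall>i\<in>S. (cmod (channel_coeff \<eta> \<alpha> (X i \<omega>) (h i \<omega>)))\<^sup>2 \<le> t}" for S
  have F: "finite F" "card F = M choose k"
    using n_subsets[of "{1..M}" k] by (auto simp: F_def)
  have E: "E S \<in> events" if "S \<in> F" for S
    unfolding E_def
  proof (intro sets.sets_Collect_finite_All)
    show "finite S" using that finite_subset[of S "{1..M}"] by (auto simp: F_def)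
    fix i assume "i \<in> S"
    with that have "i \<in> {1..M}" by (auto simp: F_def)
    note [measurable] = location_measurable[OF this] fading_measurable[OF this]
    show "{\<omega> \<in> space P. (cmod (channel_coeff \<eta> \<alpha> (X i \<omega>) (h i \<omega>)))\<^sup>2 \<le> t} \<in> events"
      by measurable
  qed
  have "{\<omega> \<in> space P. ordered_gain \<eta> \<alpha> M X h k \<omega> \<le> t} = (\<Union>S\<in>F. E S)"
    unfolding ordered_gain_le_iff[OF assms(1,2)] F_def E_def by auto
  also have "prob \<dots> \<le> (\<Sum>S\<in>F. prob (E S))"
    using F E by (intro finite_measure_subadditive_finite) auto
  also have "\<dots> \<le> (\<Sum>S\<in>F. (t * (1 + R powr \<alpha>) / \<eta>) ^ k)"
  proof (rule sum_mono)
    fix S assume "S \<in> F"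
    then have "S \<subseteq> {1..M}" "S \<noteq> {}" "card S = k" using assms by (auto simp: F_def)
    then show "prob (E S) \<le> (t * (1 + R powr \<alpha>) / \<eta>) ^ k"
      using prob_gains_le_upper[of S t] \<open>t \<ge> 0\<close> by (simp add: E_def)
  qed
  finally show ?thesis using F by simp
qed

section \<open>Diversity orders with perfect and imperfect SIC\<close>

text \<open>Without interference both outage conditions are upper thresholds on the gain
  proportional to 1/\<rho>. The outage probability is thus the distribution function of the ordered
  gain at \<open>\<tau> / \<rho>\<close>, of order \<rho> to the power -k.\<close>

lemma exf_diversity_perfect_SIC:
  assumes k: "1 \<le> k" "k \<le> M" and "b > 0" "e > 0" "e' > 0" "a > e * b"
  shows "has_diversity_order
    (exf_outage P a b e e' 0 (ordered_gain \<eta> \<alpha> M X h k) (\<lambda>\<omega>. (cmod (hI \<omega>))\<^sup>2)) (real k)"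
proof -
  note [measurable] = gain_measurable[OF k] residual_measurable
  \<comment> \<open>The maximum appears because outage occurs as soon as either threshold is not
    exceeded.\<close>
  define \<tau> where "\<tau> = max (e / (a - e * b)) (e' / b)"
  have "\<tau> > 0" using assms by (simp add: \<tau>_def max_def)
  have outage: "exf_outage P a b e e' 0 (ordered_gain \<eta> \<alpha> M X h k) (\<lambda>\<omega>. (cmod (hI \<omega>))\<^sup>2) \<rho> =
      prob {\<omega> \<in> space P. ordered_gain \<eta> \<alpha> M X h k \<omega> \<le> \<tau> / \<rho>}" if "\<rho> > 0" for \<rho>
  proof -
    have "sinr_cross a b \<rho> z \<le> e \<or> sinr_own 0 b \<rho> z y \<le> e' \<longleftrightarrow> z \<le> \<tau> / \<rho>"
      if "z \<ge> 0" "y \<ge> 0" for z y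
    proof -
      have "sinr_cross a b \<rho> z \<le> e \<longleftrightarrow> \<rho> * z \<le> e / (a - e * b)"
        using assms that \<open>\<rho> > 0\<close> by (simp add: sinr_cross_le_iff pos_le_divide_eq)
      moreover have "sinr_own 0 b \<rho> z y \<le> e' \<longleftrightarrow> \<rho> * z \<le> e' / b"
        using assms that \<open>\<rho> > 0\<close> by (simp add: sinr_own_le_iff pos_le_divide_eq)
      moreover have "z \<le> \<tau> / \<rho> \<longleftrightarrow> \<rho> * z \<le> \<tau>"
        using \<open>\<rho> > 0\<close> by (simp add: pos_le_divide_eq mult.commute)
      ultimately show ?thesis by (simp add: \<tau>_def le_max_iff_disj)
    qed
    then show ?thesis
      by (subst exf_outage_eq) (simp_all add: ordered_gain_nonneg[OF k])
  qed
  have powr: "\<rho> powr - real k = 1 / \<rho> ^ k" if "\<rho> > 0" for \<rho> :: real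
    using that by (simp add: powr_minus powr_realpow field_simps)
  show ?thesis
  proof (rule has_diversity_orderI)
    let ?c = "(exp (- (\<tau> / \<eta>)) * (\<tau> / \<eta>)) ^ k"
    let ?C = "real (M choose k) * (\<tau> * (1 + R powr \<alpha>) / \<eta>) ^ k"
    show "?c > 0" using \<open>\<tau> > 0\<close> \<eta>_pos by simp
    show "eventually (\<lambda>\<rho>. ?c * \<rho> powr - real k \<le>
        exf_outage P a b e e' 0 (ordered_gain \<eta> \<alpha> M X h k) (\<lambda>\<omega>. (cmod (hI \<omega>))\<^sup>2) \<rho>) at_top"
      using eventually_ge_at_top[of 1]
    proof eventually_elim
      case (elim \<rho>)
      then have \<rho>: "\<rho> > 0" by simp
      have "?c * \<rho> powr - real k = (exp (- (\<tau> / \<eta>)) * (\<tau> / \<rho> / \<eta>)) ^ k"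
        using \<rho> by (simp add: powr power_mult_distrib power_divide)
      \<comment> \<open>For \<open>\<rho> \<ge> 1\<close> the exponential factor is at least its
        value at \<rho> = 1, which makes the constant \<open>?c\<close> independent of
        \<rho>.\<close>
      also have "\<dots> \<le> (exp (- (\<tau> / \<rho> / \<eta>)) * (\<tau> / \<rho> / \<eta>)) ^ k"
      proof (intro power_mono mult_right_mono)
        have "\<tau> / \<rho> \<le> \<tau> / 1"
          using \<open>\<tau> > 0\<close> elim by (intro divide_left_mono) auto
        then show "exp (- (\<tau> / \<eta>)) \<le> exp (- (\<tau> / \<rho> / \<eta>))"
          using \<eta>_pos by (simp add: divide_right_mono del: divide_divide_eq_left)
      qed (use \<open>\<tau> > 0\<close> \<eta>_pos \<rho> in auto)
      also have "\<dots> \<le> prob {\<omega> \<in> space P. ordered_gain \<eta> \<alpha> M X h k \<omega> \<le> \<tau> / \<rho>}"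
        using \<open>\<tau> > 0\<close> \<rho> by (intro prob_gain_le_lower k) auto
      finally show ?case using outage \<rho> by simp
    qed
    show "eventually (\<lambda>\<rho>. exf_outage P a b e e' 0 (ordered_gain \<eta> \<alpha> M X h k)
        (\<lambda>\<omega>. (cmod (hI \<omega>))\<^sup>2) \<rho> \<le> ?C * \<rho> powr - real k) at_top"
      using eventually_gt_at_top[of 0]
    proof eventually_elim
      case (elim \<rho>)
      have "prob {\<omega> \<in> space P. ordered_gain \<eta> \<alpha> M X h k \<omega> \<le> \<tau> / \<rho>}
          \<le> real (M choose k) * (\<tau> / \<rho> * (1 + R powr \<alpha>) / \<eta>) ^ k"
        using \<open>\<tau> > 0\<close> elim by (intro prob_gain_le_upper k) auto
      also have "\<dots> = ?C * \<rho> powr - real k"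
        using elim by (simp add: powr power_mult_distrib power_divide)
      finally show ?case using outage elim by simp
    qed
  qed
qed

text \<open>The outage probability stays between a positive constant and 1: strong interference with
  a weak gain causes outage at every SNR, since \<rho> multiplies both sides of the
  comparison.\<close>

lemma exf_diversity_imperfect_SIC:
  assumes k: "1 \<le> k" "k \<le> M" and "b > 0" "e' > 0"
  shows "has_diversity_order
    (exf_outage P a b e e' 1 (ordered_gain \<eta> \<alpha> M X h k) (\<lambda>\<omega>. (cmod (hI \<omega>))\<^sup>2)) 0"
proof -
  note [measurable] = gain_measurable[OF k] residual_measurable
  \<comment> \<open>Interference of modulus at least \<open>r\<close> satisfies
    \<open>b \<le> e' * (cmod (hI \<omega>))\<^sup>2\<close>, enough for outage at any gain up to
    1.\<close>
  define r where "r = sqrt (b / e')"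
  \<comment> \<open>The ball of radius 1 about \<open>z\<close> stays outside the open disc of
    radius \<open>r\<close> about 0.\<close>
  define z :: complex where "z = of_real (r + 1)"
  have r: "r \<ge> 0" "r\<^sup>2 = b / e'"
    using assms by (auto simp: r_def)
  define c where "c = prob {\<omega> \<in> space P. hI \<omega> \<in> cball z 1 \<and>
    (\<forall>i\<in>{1..k}. h i \<omega> \<in> cball 0 (sqrt (1 / \<eta>)))}"
  have "c = prob {\<omega> \<in> space P. hI \<omega> \<in> cball z 1} *
      (\<Prod>i\<in>{1..k}. prob {\<omega> \<in> space P. h i \<omega> \<in> cball 0 (sqrt (1 / \<eta>))})"
    unfolding c_def using k by (intro prob_fading_residual) auto
  also have "\<dots> > 0"
  proof (intro mult_pos_pos prod_pos)
    have "0 < exp (- ((cmod z + 1)\<^sup>2 / \<Omega>)) * (1\<^sup>2 / \<Omega>)" using \<Omega>_pos by simp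
    also have "\<dots> \<le> prob {\<omega> \<in> space P. hI \<omega> \<in> cball z 1}"
      by (rule CN_prob_cball_ge[OF residual \<Omega>_pos]) simp
    finally show "0 < prob {\<omega> \<in> space P. hI \<omega> \<in> cball z 1}" .
    fix i assume "i \<in> {1..k}"
    then have i: "i \<in> {1..M}" using k by auto
    have "0 < exp (- ((cmod 0 + sqrt (1 / \<eta>))\<^sup>2 / 1)) * ((sqrt (1 / \<eta>))\<^sup>2 / 1)"
      using \<eta>_pos by simp
    also have "\<dots> \<le> prob {\<omega> \<in> space P. h i \<omega> \<in> cball 0 (sqrt (1 / \<eta>))}"
      using \<eta>_pos by (intro CN_prob_cball_ge[OF fading[OF i]]) auto
    finally show "0 < prob {\<omega> \<in> space P. h i \<omega> \<in> cball 0 (sqrt (1 / \<eta>))}" .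
  qed
  finally have "c > 0" .
  have own: "sinr_own 1 b \<rho> (ordered_gain \<eta> \<alpha> M X h k \<omega>) ((cmod (hI \<omega>))\<^sup>2) \<le> e'"
    if "\<rho> > 0" "hI \<omega> \<in> cball z 1" "\<forall>i\<in>{1..k}. h i \<omega> \<in> cball 0 (sqrt (1 / \<eta>))" for \<rho> \<omega>
  proof -
    let ?Z = "ordered_gain \<eta> \<alpha> M X h k \<omega>"
    have "cmod z = r + 1"
      using r by (simp add: z_def del: of_real_add)
    then have "r \<le> cmod (hI \<omega>)"
      using that(2) norm_triangle_sub[of z "hI \<omega>"] by (simp add: dist_norm)
    then have "r\<^sup>2 \<le> (cmod (hI \<omega>))\<^sup>2" using r by (intro power_mono) auto
    then have "b \<le> e' * (cmod (hI \<omega>))\<^sup>2"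
      using r assms by (simp add: field_simps)
    moreover have "?Z \<le> 1"
      using gain_le_if_fading_le[OF k, of 1] that(3) by simp
    then have "?Z * b \<le> 1 * b"
      using assms by (intro mult_right_mono) auto
    ultimately have "\<rho> * (?Z * b) \<le> \<rho> * (e' * (cmod (hI \<omega>))\<^sup>2)"
      using \<open>\<rho> > 0\<close> by (intro mult_left_mono) auto
    \<comment> \<open>The noise term adds only the positive amount \<open>e'\<close>.\<close>
    also have "\<dots> \<le> e' * (1 * \<rho> * (cmod (hI \<omega>))\<^sup>2 + 1)"
      using \<open>e' > 0\<close> by (simp add: distrib_left mult.left_commute)
    finally show ?thesis
      using \<open>\<rho> > 0\<close> by (subst sinr_own_le_iff) (simp_all only: mult.assoc, simp_all)
  qed
  show ?thesis
  proof (rule has_diversity_orderI[OF \<open>c > 0\<close>])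
    show "eventually (\<lambda>\<rho>. c * \<rho> powr - 0 \<le>
        exf_outage P a b e e' 1 (ordered_gain \<eta> \<alpha> M X h k) (\<lambda>\<omega>. (cmod (hI \<omega>))\<^sup>2) \<rho>) at_top"
      using eventually_gt_at_top[of 0]
    proof eventually_elim
      case (elim \<rho>)
      have [measurable]: "(\<lambda>\<omega>. sinr_cross a b \<rho> (ordered_gain \<eta> \<alpha> M X h k \<omega>)) \<in> borel_measurable P"
        "(\<lambda>\<omega>. sinr_own 1 b \<rho> (ordered_gain \<eta> \<alpha> M X h k \<omega>) ((cmod (hI \<omega>))\<^sup>2)) \<in> borel_measurable P"
        unfolding sinr_cross_def sinr_own_def by measurable
      have "c \<le> prob {\<omega> \<in> space P. sinr_cross a b \<rho> (ordered_gain \<eta> \<alpha> M X h k \<omega>) \<le> e \<or>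
          sinr_own 1 b \<rho> (ordered_gain \<eta> \<alpha> M X h k \<omega>) ((cmod (hI \<omega>))\<^sup>2) \<le> e'}"
        unfolding c_def using own elim by (intro finite_measure_mono) auto
      also have "\<dots> = exf_outage P a b e e' 1 (ordered_gain \<eta> \<alpha> M X h k) (\<lambda>\<omega>. (cmod (hI \<omega>))\<^sup>2) \<rho>"
        by (rule exf_outage_eq[symmetric]) measurable
      finally show ?case using elim by simp
    qed
    \<comment> \<open>By \<open>exf_outage_eq\<close> the outage is a single probability, hence at
      most 1, and \<open>\<rho> powr - 0\<close> equals 1 once \<open>\<rho> > 0\<close>.\<close>
    show "eventually (\<lambda>\<rho>. exf_outage P a b e e' 1 (ordered_gain \<eta> \<alpha> M X h k)
        (\<lambda>\<omega>. (cmod (hI \<omega>))\<^sup>2) \<rho> \<le> 1 * \<rho> powr - 0) at_top"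
      using eventually_gt_at_top[of 0]
      by eventually_elim (simp add: exf_outage_eq)
  qed
qed

end

theorem mainTheorem6:
  fixes P :: "'a measure"
    and M m n :: nat
    and \<eta> \<alpha> R\<^sub>D \<Omega>\<^sub>I a\<^sub>m a\<^sub>n R\<^sub>m R\<^sub>n \<epsilon>\<^sub>m \<epsilon>\<^sub>n :: real
    and X h :: "nat \<Rightarrow> 'a \<Rightarrow> complex"
    and h\<^sub>I :: "'a \<Rightarrow> complex"
  assumes "M \<ge> 2" "1 \<le> m" "m < n" "n \<le> M"
    and "\<eta> > 0" "\<alpha> > 0" "R\<^sub>D > 0" "\<Omega>\<^sub>I > 0"
    and "a\<^sub>m > a\<^sub>n" "a\<^sub>n > 0" "a\<^sub>m + a\<^sub>n = 1"
    and "R\<^sub>m > 0" "R\<^sub>n > 0"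
    and "\<epsilon>\<^sub>m = 2 powr R\<^sub>m - 1" "\<epsilon>\<^sub>n = 2 powr R\<^sub>n - 1"
    and "prob_space P"
    and "prob_space.indep_vars P (\<lambda>_. borel) (source_var X h h\<^sub>I) (sources M)"
    and "\<And>i. i \<in> {1..M} \<Longrightarrow> distributed P lborel (X i) (uniform_disc_density R\<^sub>D)"
    and "\<And>i. i \<in> {1..M} \<Longrightarrow> distributed P lborel (h i) (CN_density 1)"
    and "distributed P lborel h\<^sub>I (CN_density \<Omega>\<^sub>I)"
    and "a\<^sub>m > \<epsilon>\<^sub>m * a\<^sub>n"
  shows "has_diversity_order
           (exf_outage P a\<^sub>m a\<^sub>n \<epsilon>\<^sub>m \<epsilon>\<^sub>n 1
              (ordered_gain \<eta> \<alpha> M X h n) (\<lambda>\<omega>. (cmod (h\<^sub>I \<omega>))\<^sup>2)) 0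
       \<and> has_diversity_order
           (exf_outage P a\<^sub>m a\<^sub>n \<epsilon>\<^sub>m \<epsilon>\<^sub>n 0
              (ordered_gain \<eta> \<alpha> M X h n) (\<lambda>\<omega>. (cmod (h\<^sub>I \<omega>))\<^sup>2)) (real n)"
proof -
  interpret noma_channel P M \<eta> \<alpha> R\<^sub>D \<Omega>\<^sub>I X h h\<^sub>I
    using assms by (intro noma_channel.intro noma_channel_axioms.intro) auto
  have "\<epsilon>\<^sub>m > 0" "\<epsilon>\<^sub>n > 0" using assms by simp_all
  then show ?thesis
    using assms by (intro conjI exf_diversity_imperfect_SIC exf_diversity_perfect_SIC) auto
qed

end
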